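(* Let $\epsilon\in\{1,-1\}$, let $t$ be a fixed natural number, and let $\delta=2^{-1}(1-\epsilon)$. Let $f(x)$ be a regular function that is quasi-even with $f(-x)=f(x-\epsilon t)$. Then, in the sense of the generalized summation method and limits described in the context, $$\sum_{u=1}^{\infty}f(u)=\frac{1}{2}\,\epsilon\sum_{u=\delta}^{t-1+\delta}\left(\lim_{n\to\infty}f(n-\epsilon u)-f(-\epsilon u)\right)-\frac{1}{2}f(0).$$
   Context: A function $f(x)$, $x\in\mathbb{R}$, is called quasi-even if $f(-x)=f(x-a)$ for some $a\in\mathbb{Z}$. Re-ordering of $\mathbb{Z}$: $a\prec b$ iff $\frac{-1}{a}<\frac{-1}{b}$ (convention $0^{-1}=\infty$), so that $0\prec 1\prec 2\prec\cdots\prec -2\prec -1$ (first element $0$, last element $-1$). Intervals $[a,b]$, $(a,b)$ are taken with respect to $\prec$. Put $\mathbb{Z}_{a,b}=[a,b]$ if $a\preceq b$, and $\mathbb{Z}_{a,b}=\mathbb{Z}\setminus(b,a)=[a,-1]\cup[0,b]$ if $b\prec a$. For a function $f$ on $\mathbb{Z}$ and any $a,b\in\mathbb{Z}$, $\sum_{u=a}^{b}f(u):=\sum_{u\in\mathbb{Z}_{a,b}}f(u)$ (observing the order of elements in $\mathbb{Z}_{a,b}$); if $\mathbb{Z}_{a,b}$ is infinite this is an infinite series. An elementary function is one given by a formula built by finitely many algebraic operations, compositions and combinations from constant, algebraic, trigonometric and exponential functions and their inverses. A function $f$ on $\mathbb{Z}$ is regular if there is an elementary function $F$ (a primitive of $f$)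 with $F(x+1)-F(x)=f(x)$ for all $x\in\mathbb{Z}$. Summation method. Postulate: every series $\sum_{u=1}^{\infty}f(u)$ with $f$ regular has a certain finite numeric value. Axioms: (A1) if $S_n=\sum_{u=a}^{n}f(u)$ for all $n$, then $\lim_{n\to\infty}S_n=\sum_{u=a}^{\infty}f(u)$; (A2) if $S_n=\sum_{u=1}^{[n/2]}f(u)$ for all $n$, then $\lim_{n\to\infty}S_n=\sum_{u=1}^{\infty}f(u)$ ($[\cdot]$ = integer part); (A3) if $\sum_{u=a}^{\infty}f_1(u)=S_1$ and $\sum_{u=a}^{\infty}f_2(u)=S_2$, then $\sum_{u=a}^{\infty}(\alpha_1f_1(u)+\alpha_2f_2(u))=\alpha_1S_1+\alpha_2S_2$; (A4) if $G=[a_1,b_1]\cup[a_2,b_2]$ with $[a_1,b_1]\cap[a_2,b_2]=\emptyset$, then $\sum_{u\in G}f(u)=\sum_{u=a_1}^{b_1}f(u)+\sum_{u=a_2}^{b_2}f(u)$. Limits: $\lim_{n\to\infty}F(n)=A$ means $\sum_{u=1}^{\infty}f(u)=A$ where $f(1)=F(1)$ and $f(u)=F(u)-F(u-1)$ for $u>1$; by the postulate every elementary function of an integer argument defined on $\mathbb{Z}$ has a definite limit. All limits and infinite sums are understood in this generalized sense (agreeing with the usual one for convergent sequences and series). Conventions: sums retain their analytical expression, i.e. for $f$ regular with primitive $F$, $\sum_{u=a}^{b}f(u)=F(b+1)-F(a)$ whenever $a\preceq b$; and $\lim_{n\to\infty}\sum_{u\in\mathbb{Z}_{-n,n}}f(u)=\sum_{u\in\mathbb{Z}}f(u)$.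 *)

theory Defs
  imports "HOL-Analysis.Analysis"
begin

definition quasi_even :: "(real \<Rightarrow> real) \<Rightarrow> bool" where
  "quasi_even f \<longleftrightarrow> (\<exists>a::int. \<forall>x::real. f (- x) = f (x - of_int a))"

text \<open>The re-ordering of the integers. In the extended reals \<open>inverse 0 = \<infinity>\<close>, so that \<open>0\<close> is the
  first element and \<open>-1\<close> the last.\<close>

definition zless :: "int \<Rightarrow> int \<Rightarrow> bool" (infix "\<prec>\<^sub>Z" 50) where
  "a \<prec>\<^sub>Z b \<longleftrightarrow> - inverse (ereal (of_int a)) < - inverse (ereal (of_int b))"

definition zle :: "int \<Rightarrow> int \<Rightarrow> bool" (infix "\<preceq>\<^sub>Z" 50) where
  "a \<preceq>\<^sub>Z b \<longleftrightarrow> a \<prec>\<^sub>Z b \<or> a = b"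

definition zclosed :: "int \<Rightarrow> int \<Rightarrow> int set" where
  "zclosed a b = {u. a \<preceq>\<^sub>Z u \<and> u \<preceq>\<^sub>Z b}"

definition zopen :: "int \<Rightarrow> int \<Rightarrow> int set" where
  "zopen a b = {u. a \<prec>\<^sub>Z u \<and> u \<prec>\<^sub>Z b}"

definition Zint :: "int \<Rightarrow> int \<Rightarrow> int set" where
  "Zint a b = (if a \<preceq>\<^sub>Z b then zclosed a b else UNIV - zopen b a)"

lemma zless_iff:
  "a \<prec>\<^sub>Z b \<longleftrightarrow> (if 0 \<le> a then a < b \<or> b < 0 else a < b \<and> b < 0)"
proof -
  consider "a = 0" | "a > 0" | "a < 0" by linarith
  then show ?thesis
  proof cases
    case 1
    then show ?thesis by (auto simp: zless_def)
  next
    case 2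
    then show ?thesis
      by (cases "b = 0"; cases "b > 0") (auto simp: zless_def divide_simps)
  next
    case 3
    then show ?thesis
      by (cases "b = 0"; cases "b > 0") (auto simp: zless_def divide_simps)
  qed
qed

lemma zle_iff:
  "a \<preceq>\<^sub>Z b \<longleftrightarrow> (if 0 \<le> a then a \<le> b \<or> b < 0 else a \<le> b \<and> b < 0)"
  by (auto simp: zle_def zless_iff)

lemma Zint_wrap:
  assumes "b \<prec>\<^sub>Z a"
  shows "Zint a b = zclosed a (-1) \<union> zclosed 0 b"
proof -
  have "\<not> a \<preceq>\<^sub>Z b"
    using assms by (auto simp: zle_iff zless_iff split: if_splits)
  moreover have "\<not> (b \<prec>\<^sub>Z u \<and> u \<prec>\<^sub>Z a) \<longleftrightarrow> a \<preceq>\<^sub>Z u \<and> u \<preceq>\<^sub>Z -1 \<or> 0 \<preceq>\<^sub>Z u \<and> u \<preceq>\<^sub>Z b" for u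
    using assms unfolding zle_iff zless_iff by presburger
  ultimately show ?thesis
    unfolding Zint_def zclosed_def zopen_def by auto
qed

text \<open>\<open>elementary_on D F\<close>: there is a formula for \<open>F\<close> all of whose subterms are defined on \<open>D\<close> (the
  side conditions exclude the values that division by zero, logarithms of non-positive numbers etc.
  have by convention). An algebraic function is a continuous real branch, on an interval, of
  \<open>P(x, y) = 0\<close> with \<open>P \<noteq> 0\<close>; \<open>P\<close> is read as a polynomial in \<open>y\<close> with coefficients in \<open>\<real>[x]\<close>.
  Quotients and compositions give the tangent, general powers and general exponentials.\<close>

inductive elementary_on :: "real set \<Rightarrow> (real \<Rightarrow> real) \<Rightarrow> bool" where
  const: "elementary_on D (\<lambda>_. c)"
| ident: "elementary_on D (\<lambda>x. x)"
| algebraic: "\<lbrakk>connected I; continuous_on I g; P \<noteq> (0 :: real poly poly);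
    \<forall>x\<in>I. poly (poly P [:g x:]) x = 0\<rbrakk> \<Longrightarrow> elementary_on I g"
| exp: "elementary_on UNIV exp"
| sin: "elementary_on UNIV sin"
| cos: "elementary_on UNIV cos"
| ln: "elementary_on {0<..} ln"
| arcsin: "elementary_on {-1..1} arcsin"
| arccos: "elementary_on {-1..1} arccos"
| arctan: "elementary_on UNIV arctan"
| add: "elementary_on D F \<Longrightarrow> elementary_on D G \<Longrightarrow> elementary_on D (\<lambda>x. F x + G x)"
| diff: "elementary_on D F \<Longrightarrow> elementary_on D G \<Longrightarrow> elementary_on D (\<lambda>x. F x - G x)"
| mult: "elementary_on D F \<Longrightarrow> elementary_on D G \<Longrightarrow> elementary_on D (\<lambda>x. F x * G x)"
| divide: "\<lbrakk>elementary_on D F; elementary_on D G; \<forall>x\<in>D. G x \<noteq> 0\<rbrakk>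
    \<Longrightarrow> elementary_on D (\<lambda>x. F x / G x)"
| compose: "\<lbrakk>elementary_on D F; elementary_on D' G; F ` D \<subseteq> D'\<rbrakk>
    \<Longrightarrow> elementary_on D (\<lambda>x. G (F x))"

definition elementary :: "(int \<Rightarrow> real) \<Rightarrow> bool" where
  "elementary F \<longleftrightarrow> (\<exists>G. elementary_on \<int> G \<and> (\<forall>x. F x = G (of_int x)))"

text \<open>The postulates below cannot be imposed on \<^emph>\<open>all\<close> elementary functions without contradiction:
  for \<open>F = tanh\<close> the sum of \<open>F (x + 1) - F x\<close> over all integers would be both \<open>F 0 - F 0 = 0\<close> and
  the limit \<open>2\<close> of the symmetric partial sums. Hence the class \<open>E\<close> of elementary functions to which
  the method is applied is a parameter. \<open>E = Collect elementary\<close> is the unrestricted setting (see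
  \<open>elementary_class_elementary\<close>); the polynomial functions are a class for which the
  postulates are satisfiable.\<close>

locale elementary_class =
  fixes E :: "(int \<Rightarrow> real) set"
  assumes elementary: "F \<in> E \<Longrightarrow> elementary F"
    and lincomb: "F \<in> E \<Longrightarrow> G \<in> E \<Longrightarrow> (\<lambda>x. \<alpha> * F x + \<beta> * G x) \<in> E"
    and shift: "F \<in> E \<Longrightarrow> (\<lambda>x. F (x + k)) \<in> E"

definition primitive_of :: "(int \<Rightarrow> real) \<Rightarrow> (int \<Rightarrow> real) \<Rightarrow> bool" where
  "primitive_of F f \<longleftrightarrow> (\<forall>x. F (x + 1) - F x = f x)"

definition regular :: "(int \<Rightarrow> real) set \<Rightarrow> (int \<Rightarrow> real) \<Rightarrow> bool" where
  "regular E f \<longleftrightarrow> (\<exists>F\<in>E. primitive_of F f)"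

lemma elementary_class_elementary: "elementary_class (Collect elementary)"
proof
  fix F G :: "int \<Rightarrow> real" and \<alpha> \<beta> :: real
  assume "F \<in> Collect elementary" "G \<in> Collect elementary"
  then obtain F' G' where "elementary_on \<int> F'" "elementary_on \<int> G'"
    and *: "\<And>x. F x = F' (of_int x)" "\<And>x. G x = G' (of_int x)"
    by (auto simp: elementary_def)
  then have "elementary_on \<int> (\<lambda>x. \<alpha> * F' x + \<beta> * G' x)"
    by (intro elementary_on.add elementary_on.mult elementary_on.const)
  with * show "(\<lambda>x. \<alpha> * F x + \<beta> * G x) \<in> Collect elementary"
    by (auto simp: elementary_def)
next
  fix F :: "int \<Rightarrow> real" and k :: int
  assume "F \<in> Collect elementary"
  then obtain F' where F': "elementary_on \<int> F'" and *: "\<And>x. F x = F' (of_int x)"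
    by (auto simp: elementary_def)
  have "elementary_on \<int> (\<lambda>x. x + of_int k)"
    by (intro elementary_on.add elementary_on.ident elementary_on.const)
  from this F' have "elementary_on \<int> (\<lambda>x. F' (x + of_int k))"
    by (rule elementary_on.compose) auto
  with * show "(\<lambda>x. F (x + k)) \<in> Collect elementary"
    by (auto simp: elementary_def intro!: exI[of _ "\<lambda>x. F' (x + of_int k)"])
qed simp

text \<open>A summation method is a relation \<open>V\<close>, where \<open>V G f s\<close> means that the sum of \<open>f u\<close> over
  \<open>u \<in> G\<close> has the value \<open>s\<close>. The index set \<open>G\<close> is a half-line \<open>{a..}\<close>, for the series
  \<open>\<Sum>\<^sub>u\<^sub>=\<^sub>a\<^sup>\<infinity> f u\<close> with terms in their usual order, or a set \<open>Zint a b\<close>, or a union of intervals of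
  \<open>\<prec>\<^sub>Z\<close>.\<close>

type_synonym summation = "int set \<Rightarrow> (int \<Rightarrow> real) \<Rightarrow> real \<Rightarrow> bool"

definition has_glim :: "summation \<Rightarrow> (int \<Rightarrow> real) \<Rightarrow> real \<Rightarrow> bool" where
  "has_glim V F A \<longleftrightarrow> V {1..} (\<lambda>u. if u = 1 then F 1 else F u - F (u - 1)) A"

definition gsum :: "summation \<Rightarrow> int set \<Rightarrow> (int \<Rightarrow> real) \<Rightarrow> real" where
  "gsum V G f = (THE s. V G f s)"

definition glim :: "summation \<Rightarrow> (int \<Rightarrow> real) \<Rightarrow> real" where
  "glim V F = (THE A. has_glim V F A)"

locale summation_method = elementary_class E for E :: "(int \<Rightarrow> real) set" +
  fixes V :: summation
  assumes unique: "V G f s \<Longrightarrow> V G f s' \<Longrightarrow> s = s'"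
    and cong: "(\<And>u. u \<in> G \<Longrightarrow> f u = g u) \<Longrightarrow> V G f s \<Longrightarrow> V G g s"
    and finite_sum: "finite G \<Longrightarrow> V G f (sum f G)"
    and convergent_series: "(\<lambda>n. f (a + int n)) sums s \<Longrightarrow> V {a..} f s"
    and postulate: "regular E f \<Longrightarrow> \<exists>s. V {1..} f s"
    and A1: "(\<And>n. n \<ge> 1 \<Longrightarrow> V (Zint a n) f (S n)) \<Longrightarrow> has_glim V S s \<longleftrightarrow> V {a..} f s"
    and A2: "(\<And>n. n \<ge> 1 \<Longrightarrow> V (Zint 1 (n div 2)) f (S n)) \<Longrightarrow> has_glim V S s \<longleftrightarrow> V {1..} f s"
    and A3: "V {a..} f\<^sub>1 s\<^sub>1 \<Longrightarrow> V {a..} f\<^sub>2 s\<^sub>2 \<Longrightarrow>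
      V {a..} (\<lambda>u. \<alpha>\<^sub>1 * f\<^sub>1 u + \<alpha>\<^sub>2 * f\<^sub>2 u) (\<alpha>\<^sub>1 * s\<^sub>1 + \<alpha>\<^sub>2 * s\<^sub>2)"
    and A4: "zclosed a\<^sub>1 b\<^sub>1 \<inter> zclosed a\<^sub>2 b\<^sub>2 = {} \<Longrightarrow>
      V (zclosed a\<^sub>1 b\<^sub>1) f s\<^sub>1 \<Longrightarrow> V (zclosed a\<^sub>2 b\<^sub>2) f s\<^sub>2 \<Longrightarrow>
      V (zclosed a\<^sub>1 b\<^sub>1 \<union> zclosed a\<^sub>2 b\<^sub>2) f (s\<^sub>1 + s\<^sub>2)"
    and analytic_expression: "F \<in> E \<Longrightarrow> primitive_of F f \<Longrightarrow> a \<preceq>\<^sub>Z b \<Longrightarrow>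
      V (Zint a b) f (F (b + 1) - F a)"
    and symmetric_limit: "regular E f \<Longrightarrow> (\<And>n. n \<ge> 1 \<Longrightarrow> V (Zint (- n) n) f (S n)) \<Longrightarrow>
      V UNIV f s \<Longrightarrow> has_glim V S s"
begin

lemma gsum_eq: "V G f s \<Longrightarrow> gsum V G f = s"
  unfolding gsum_def by (blast intro: unique)

lemma glim_eq: "has_glim V F A \<Longrightarrow> glim V F = A"
  unfolding glim_def has_glim_def by (blast intro: unique)

lemma has_glim_exists:
  assumes "F \<in> E"
  shows "\<exists>A. has_glim V F A"
proof -
  have "(\<lambda>x. F (x + (-1))) \<in> E"
    using assms by (rule shift)
  moreover have "primitive_of (\<lambda>x. F (x + (-1))) (\<lambda>u. F u - F (u - 1))"
    by (simp add: primitive_of_def)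
  ultimately obtain s where s: "V {1..} (\<lambda>u. F u - F (u - 1)) s"
    using postulate unfolding regular_def by blast
  have "(\<lambda>n. if n \<in> {0::nat} then F 0 else 0) sums (\<Sum>n\<in>{0::nat}. F 0)"
    by (rule sums_If_finite_set) simp
  then have "(\<lambda>n. (\<lambda>u. if u = 1 then F 0 else 0) (1 + int n)) sums F 0"
    by (simp add: eq_commute)
  then have "V {1..} (\<lambda>u. if u = 1 then F 0 else 0) (F 0)"
    by (rule convergent_series)
  from A3[OF s this, of 1 1]
  have *: "V {1..} (\<lambda>u. 1 * (F u - F (u - 1)) + 1 * (if u = 1 then F 0 else 0)) (s + F 0)"
    by simp
  have "V {1..} (\<lambda>u. if u = 1 then F 1 else F u - F (u - 1)) (s + F 0)"
    by (rule cong[OF _ *]) simp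
  then show ?thesis
    by (auto simp: has_glim_def)
qed

end

end

theory Submission
  imports Defs
begin

text \<open>The sum of \<open>f\<close> over all integers is \<open>0\<close>, since \<open>\<int>\<close> is the single interval \<open>[0,-1]\<close> and the
  analytic expression gives \<open>F 0 - F 0\<close>. The symmetric partial sums consist of \<open>f 0\<close>, the sum of
  \<open>f u\<close> and the sum of \<open>f (-u) = f (u - \<epsilon> t)\<close> over \<open>1 \<le> u \<le> n\<close>. The last two differ by \<open>t\<close>
  boundary terms at either end, so passing to the limit leaves a linear equation for the sum of
  \<open>f\<close> over the positive integers.\<close>

context summation_method
begin

text \<open>The series of differences has \<open>c\<close> as its first term and zeros after it, so
  it converges in the ordinary sense.\<close>

lemma has_glim_const: "has_glim V (\<lambda>_. c) c"
proof -
  have "(\<lambda>n. if n \<in> {0::nat} then c else 0) sums (\<Sum>n\<in>{0::nat}. c)"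
    by (rule sums_If_finite_set) simp
  then have "(\<lambda>n. (\<lambda>u::int. if u = 1 then c else 0) (1 + int n)) sums c"
    by (simp add: eq_commute)
  from convergent_series[OF this] show ?thesis
    by (simp add: has_glim_def cong: if_cong)
qed

lemma has_glim_lincomb:
  assumes "has_glim V F A" "has_glim V G B"
  shows "has_glim V (\<lambda>n. \<alpha> * F n + \<beta> * G n) (\<alpha> * A + \<beta> * B)"
  unfolding has_glim_def
  by (rule cong[OF _ A3[OF assms[unfolded has_glim_def], of \<alpha> \<beta>]])
    (auto simp: algebra_simps)

lemma has_glim_sum:
  assumes "\<And>i. i \<in> I \<Longrightarrow> has_glim V (F i) (A i)"
  shows "has_glim V (\<lambda>n. \<Sum>i\<in>I. F i n) (\<Sum>i\<in>I. A i)"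
  using assms
proof (induction I rule: infinite_finite_induct)
  case (insert i I)
  then show ?case
    using has_glim_lincomb[of "F i" "A i" "\<lambda>n. \<Sum>i\<in>I. F i n" "\<Sum>i\<in>I. A i" 1 1] by simp
\<comment> \<open>In the remaining cases, \<open>I\<close> empty or infinite, both sums are
  0.\<close>
qed (simp_all add: has_glim_const)

lemma V_zclosed:
  assumes "F \<in> E" "primitive_of F g" "a \<preceq>\<^sub>Z b"
  shows "V (zclosed a b) g (F (b + 1) - F a)"
  using analytic_expression[OF assms] assms(3) by (simp add: Zint_def)

lemma V_UNIV:
  assumes "regular E g"
  shows "V UNIV g 0"
proof -
  from assms obtain F where F: "F \<in> E" "primitive_of F g"
    unfolding regular_def by blast
  have "zclosed 0 (- 1) = UNIV"
    by (auto simp: zclosed_def zle_iff)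
  with V_zclosed[OF F, of 0 "- 1"] show ?thesis
    by (simp add: zle_iff)
qed

text \<open>Here \<open>n\<close> precedes \<open>-n\<close>, so \<open>analytic_expression\<close>
  does not apply directly. It does apply to the two intervals into which the wrapped set splits, and
  \<open>F 0\<close> cancels.\<close>

lemma V_symmetric:
  assumes "F \<in> E" "primitive_of F g" "n \<ge> 1"
  shows "V (Zint (- n) n) g (F (n + 1) - F (- n))"
proof -
  have "zclosed (- n) (- 1) \<inter> zclosed 0 n = {}"
    using assms(3) by (auto simp: zclosed_def zle_iff split: if_splits)
  moreover have "V (zclosed (- n) (- 1)) g (F 0 - F (- n))"
    using V_zclosed[OF assms(1,2), of "- n" "- 1"] assms(3) by (simp add: zle_iff)
  moreover have "V (zclosed 0 n) g (F (n + 1) - F 0)"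
    using V_zclosed[OF assms(1,2), of 0 n] assms(3) by (simp add: zle_iff)
  ultimately have "V (zclosed (- n) (- 1) \<union> zclosed 0 n) g
      (F 0 - F (- n) + (F (n + 1) - F 0))"
    by (rule A4)
  moreover have "n \<prec>\<^sub>Z - n"
    using assms(3) by (simp add: zless_iff)
  ultimately show ?thesis
    by (simp add: Zint_wrap)
qed

text \<open>As a difference of shifts of its primitive, \<open>g\<close> itself lies in
  \<open>E\<close>.\<close>

lemma regular_has_glim_shift:
  assumes "regular E g"
  shows "\<exists>A. has_glim V (\<lambda>n. g (n + k)) A"
proof -
  from assms obtain F where F: "F \<in> E" "primitive_of F g"
    unfolding regular_def by blast
  have "(\<lambda>n. 1 * F (n + (k + 1)) + (- 1) * F (n + k)) \<in> E"
    by (intro lincomb shift F)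
  also have "(\<lambda>n. 1 * F (n + (k + 1)) + (- 1) * F (n + k)) = (\<lambda>n. g (n + k))"
    using F(2) by (simp add: primitive_of_def flip: add.assoc)
  finally show ?thesis
    by (rule has_glim_exists)
qed

end

lemma primitive_shift_pos:
  assumes "primitive_of F g"
  shows "F (x + 1) - F (x + 1 - int t) = (\<Sum>u = 0..int t - 1. g (x - u))"
proof (induction t)
  case (Suc t)
  have "{0..int (Suc t) - 1} = insert (int t) {0..int t - 1}"
    by auto
  moreover have "F (x - int t + 1) - F (x - int t) = g (x - int t)"
    using assms by (simp add: primitive_of_def)
  ultimately show ?case
    using Suc by (simp add: algebra_simps)
qed simp

lemma primitive_shift_neg:
  assumes "primitive_of F g"
  shows "F (x + 1 + int t) - F (x + 1) = (\<Sum>u = 1..int t. g (x + u))"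
  \<comment> \<open>Start \<open>t\<close> steps higher and reverse the order of summation.\<close>
  using primitive_shift_pos[OF assms, of "x + int t" t]
    sum.reindex_bij_witness[of "{1..int t}" "\<lambda>u. int t - u" "\<lambda>u. int t - u" "{0..int t - 1}"
      "\<lambda>u. g (x + int t - u)" "\<lambda>u. g (x + u)"]
  by (simp add: algebra_simps)

text \<open>For \<open>\<epsilon> = -1\<close> the shift goes upwards: the terms then start at
  \<open>x + 1\<close> instead of \<open>x\<close>, hence \<open>\<delta> = 1\<close>, and the
  difference changes sign.\<close>

lemma primitive_shift:
  assumes "primitive_of F g" "\<epsilon> = 1 \<and> \<delta> = 0 \<or> \<epsilon> = - 1 \<and> \<delta> = 1"
  shows "F (x + 1) - F (x + 1 - \<epsilon> * int t) =
    real_of_int \<epsilon> * (\<Sum>u = \<delta>..int t - 1 + \<delta>. g (x - \<epsilon> * u))"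
  using assms(2) primitive_shift_pos[OF assms(1), of x t] primitive_shift_neg[OF assms(1), of x t]
  by auto

text \<open>The left side telescopes to the sum of \<open>g (-u)\<close> and the right side to that
  of \<open>g (u - k)\<close>, both over \<open>u\<close> from 1 to \<open>n\<close>.\<close>

lemma primitive_reflect:
  assumes "primitive_of F g" "\<And>x. g (- x) = g (x - k)"
  shows "F 0 - F (- int n) = F (int n + 1 - k) - F (1 - k)"
proof (induction n)
  case (Suc n)
  have "F (- int n) - F (- 1 - int n) = g (- 1 - int n)"
    using assms(1)[unfolded primitive_of_def, rule_format, of "- 1 - int n"] by simp
  moreover have "F (int n + 2 - k) - F (int n + 1 - k) = g (int n + 1 - k)"
    using assms(1)[unfolded primitive_of_def, rule_format, of "int n + 1 - k"]
    by (simp add: algebra_simps)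
  ultimately show ?case
    using Suc assms(2)[of "int n + 1"] by (simp add: algebra_simps)
qed simp

text \<open>Stating this with \<open>V\<close> makes the existence of the value part of the claim;
  \<open>gsum\<close> then follows by uniqueness.\<close>

lemma (in summation_method) V_positive_quasi_even:
  fixes t :: nat
  assumes reg: "regular E g"
    and reflect: "\<And>x. g (- x) = g (x - \<epsilon> * int t)"
    and \<epsilon>: "\<epsilon> = 1 \<and> \<delta> = 0 \<or> \<epsilon> = - 1 \<and> \<delta> = 1"
  shows "V {1..} g (1 / 2 * real_of_int \<epsilon> *
      (\<Sum>u = \<delta>..int t - 1 + \<delta>. glim V (\<lambda>n. g (n - \<epsilon> * u)) - g (- (\<epsilon> * u)))
    - 1 / 2 * g 0)"
proof -
  from reg obtain F where F: "F \<in> E" "primitive_of F g"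
    unfolding regular_def by blast
  from postulate[OF reg] obtain c where c: "V {1..} g c"
    by blast
  let ?I = "{\<delta>..int t - 1 + \<delta>}"
  let ?B = "\<lambda>n. \<Sum>u\<in>?I. g (n - \<epsilon> * u)"
  let ?L = "\<Sum>u\<in>?I. glim V (\<lambda>n. g (n - \<epsilon> * u))"
  \<comment> \<open>The symmetric partial sum, with the factors 1 written out so that
    \<open>has_glim_lincomb\<close> matches twice.\<close>
  let ?S = "\<lambda>n. 2 * (F (n + 1) - F 1) + 1 * (1 * (g 0 + real_of_int \<epsilon> * ?B 0) +
    (- real_of_int \<epsilon>) * ?B n)"
  have "has_glim V (\<lambda>n. F (n + 1) - F 1) c \<longleftrightarrow> V {1..} g c"
    by (rule A1, rule analytic_expression[OF F]) (simp add: zle_iff)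
  with c have T: "has_glim V (\<lambda>n. F (n + 1) - F 1) c"
    by simp
  have "has_glim V (\<lambda>n. g (n - \<epsilon> * u)) (glim V (\<lambda>n. g (n - \<epsilon> * u)))" for u
    using regular_has_glim_shift[OF reg, of "- (\<epsilon> * u)"] glim_eq by auto
  then have B: "has_glim V ?B ?L"
    by (intro has_glim_sum)
  have "has_glim V ?S (2 * c + 1 * (1 * (g 0 + real_of_int \<epsilon> * ?B 0) + (- real_of_int \<epsilon>) * ?L))"
    by (intro has_glim_lincomb has_glim_const T B)
  moreover have "has_glim V ?S 0"
  proof (rule symmetric_limit[OF reg _ V_UNIV[OF reg]])
    fix n :: int
    assume "n \<ge> 1"
    have "F 0 - F (- n) = F (n + 1 - \<epsilon> * int t) - F (1 - \<epsilon> * int t)"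
      using primitive_reflect[OF F(2) reflect, of "nat n"] \<open>n \<ge> 1\<close> by simp
    moreover have "F 1 - F 0 = g 0"
      using F(2)[unfolded primitive_of_def, rule_format, of 0] by simp
    \<comment> \<open>Split at \<open>F 0 = F 1 - g 0\<close>. Applied at \<open>n\<close> and at 0,
      \<open>primitive_shift\<close> trades the shifted values of \<open>F\<close> for
      \<open>F (n + 1)\<close> and \<open>F 1\<close>, at the cost of the boundary sums
      \<open>?B n\<close> and \<open>?B 0\<close>.\<close>
    ultimately have "F (n + 1) - F (- n) = ?S n"
      using primitive_shift[OF F(2) \<epsilon>, of n t] primitive_shift[OF F(2) \<epsilon>, of 0 t]
      by simp
    with V_symmetric[OF F \<open>n \<ge> 1\<close>] show "V (Zint (- n) n) g (?S n)"
      by (simp only:)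
  qed
  \<comment> \<open>The two limits found for \<open>?S\<close> coincide.\<close>
  ultimately have "2 * c + (g 0 + real_of_int \<epsilon> * ?B 0) - real_of_int \<epsilon> * ?L = 0"
    using unique unfolding has_glim_def by fastforce
  then have "c = 1 / 2 * real_of_int \<epsilon> * (?L - ?B 0) - 1 / 2 * g 0"
    by (simp add: algebra_simps)
  with c show ?thesis
    by (simp add: sum_subtractf)
qed

theorem theorem4p6:
  fixes E :: "(int \<Rightarrow> real) set" and V :: summation
    and f :: "real \<Rightarrow> real" and \<epsilon> \<delta> :: int and t :: nat
  assumes "summation_method E V"
    and "\<epsilon> \<in> {1, -1}"
    and "real_of_int \<delta> = (1 - real_of_int \<epsilon>) / 2"
    and "regular E (\<lambda>x. f (real_of_int x))"
    and "quasi_even f"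
    and "\<forall>x. f (- x) = f (x - real_of_int \<epsilon> * real t)"
  shows "gsum V {1..} (\<lambda>u. f (real_of_int u)) =
    1 / 2 * real_of_int \<epsilon> *
      (\<Sum>u = \<delta>..int t - 1 + \<delta>.
         glim V (\<lambda>n. f (real_of_int n - real_of_int \<epsilon> * real_of_int u))
           - f (- real_of_int \<epsilon> * real_of_int u))
    - 1 / 2 * f 0"
proof -
  interpret summation_method E V
    by (rule assms(1))
  let ?g = "\<lambda>x. f (real_of_int x)"
  have \<epsilon>: "\<epsilon> = 1 \<and> \<delta> = 0 \<or> \<epsilon> = - 1 \<and> \<delta> = 1"
    using assms(2,3) by auto
  have reflect: "?g (- x) = ?g (x - \<epsilon> * int t)" for x
    using assms(6) by simp
  show ?thesis
    using gsum_eq[OF V_positive_quasi_even[of ?g, OF assms(4) reflect \<epsilon>]] by simp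
qed

end
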